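(* Let $G$ be a noncyclic finite abelian group with basis $\sigma=\{\sigma_1,\ldots,\sigma_r\}$, let $K/F$ be a $G$-Galois extension of fields, and let $\Delta=(K/F,z_\sigma,u,b)$ be an abelian crossed product. The matrix $u$ is strongly degenerate if and only if there exists a prime $q$ such that $\Delta$ has a $q$-power central element of the form $lz^{\overline m}$ for $l\in K^*$ and $\overline m\in\mathbb{N}^r-\{\overline 0\}$.
   Context: Abelian crossed product: with $G=\langle\sigma_1\rangle\times\cdots\times\langle\sigma_r\rangle$, $n_i=|\sigma_i|$, and $K/F$ a $G$-Galois extension, $\Delta=(K/F,z_\sigma,u,b)$ denotes a central simple $F$-algebra containing $K$ as a maximal subfield, together with units $z_1,\ldots,z_r\in\Delta$ such that $z_i k z_i^{-1}=\sigma_i(k)$ for $k\in K$; here $u=(u_{ij})$ is the $r\times r$ matrix with entries $u_{ij}=z_iz_jz_i^{-1}z_j^{-1}\in K^*$, and $b=\{b_i\}_{i=1}^r$ with $b_i=z_i^{n_i}\in K^*$. Thus $\Delta=\bigoplus_{0\le m_i<n_i}K\,z_1^{m_1}\cdots z_r^{m_r}$. Notation: for $\overline m=(m_1,\ldots,m_r)\in\mathbb{N}^r$ (with $0\in\mathbb{N}$) put $\sigma^{\overline m}=\sigma_1^{m_1}\cdots\sigma_r^{m_r}\in G$, $z^{\overline m}=z_1^{m_1}\cdots z_r^{m_r}$, and $u_{i,\overline m}=z_iz^{\overline m}z_i^{-1}(z^{\overline m})^{-1}\in K^*$; $\overline 0=(0,\ldots,0)$ is the zero vector. Strong degeneracy: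 $u$ is strongly degenerate if there exist an element $\sigma^{\overline m}\in G$ of prime order and elements $l,x_1,\ldots,x_r\in K^*$ such that $u_{i,\overline m}=\frac{\sigma^{\overline m}(x_i)}{x_i}\cdot\frac{l}{\sigma_i(l)}$ for all $1\le i\le r$. A $q$-power central element is a non-central element whose $q$-th power is central. The characteristic of $F$ is arbitrary.
   Formalization: The exponent vector m is also required to satisfy σ^m ≠ 1 (equivalently, m is nonzero after reducing each m_i modulo n_i), since otherwise l z^m could be any element of K* and the equivalence fails, e.g. for Z/2×Z/2 crossed products of degree and exponent 4. *)

theory Defs
  imports "HOL-Algebra.Algebra"
begin

text \<open>
  All fields below are subfields of one ambient ring \<open>A\<close>, which need not be commutative.
\<close>

definition galois_group ::
    "('a, 'b) ring_scheme \<Rightarrow> 'a set \<Rightarrow> 'a set \<Rightarrow> ('a \<Rightarrow> 'a) monoid" where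
  "galois_group A F K = BijGroup K
     \<lparr>carrier := {f \<in> Bij K. f \<in> ring_hom (A\<lparr>carrier := K\<rparr>) (A\<lparr>carrier := K\<rparr>)
                     \<and> (\<forall>x\<in>F. f x = x)}\<rparr>"

definition galois_extension :: "('a, 'b) ring_scheme \<Rightarrow> 'a set \<Rightarrow> 'a set \<Rightarrow> bool" where
  "galois_extension A F K \<longleftrightarrow>
     subfield F A \<and> subfield K A \<and> F \<subseteq> K \<and> ring.finite_dimension A F K \<and>
     {x \<in> K. \<forall>f \<in> carrier (galois_group A F K). f x = x} = F"

text \<open>
  A \<open>G\<close>-Galois extension comes with an identification \<open>\<phi>\<close> of the abstract group \<open>G\<close> with
  the Galois group; \<open>\<phi> g k\<close> is the result of applying \<open>g\<close> to \<open>k\<close>.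
\<close>

definition G_galois_extension ::
    "('a, 'b) ring_scheme \<Rightarrow> 'a set \<Rightarrow> 'a set \<Rightarrow> ('g, 'c) monoid_scheme \<Rightarrow> ('g \<Rightarrow> 'a \<Rightarrow> 'a) \<Rightarrow> bool"
  where
  "G_galois_extension A F K G \<phi> \<longleftrightarrow> galois_extension A F K \<and> \<phi> \<in> iso G (galois_group A F K)"

text \<open>
  \<open>G\<close> is the internal direct product of the cyclic subgroups generated by \<open>\<sigma> 1, \<dots>, \<sigma> r\<close>.
\<close>

definition group_basis :: "('g, 'c) monoid_scheme \<Rightarrow> nat \<Rightarrow> (nat \<Rightarrow> 'g) \<Rightarrow> bool" where
  "group_basis G r \<sigma> \<longleftrightarrow>
     (\<forall>i\<in>{1..r}. \<sigma> i \<in> carrier G) \<and>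
     (\<lambda>f. finprod G f {1..r}) \<in> iso (product_group {1..r} (\<lambda>i. subgroup_generated G {\<sigma> i})) G"

definition ring_center :: "('a, 'b) ring_scheme \<Rightarrow> 'a set" where
  "ring_center A = {x \<in> carrier A. \<forall>y \<in> carrier A. x \<otimes>\<^bsub>A\<^esub> y = y \<otimes>\<^bsub>A\<^esub> x}"

text \<open>The library predicate \<open>ideal\<close> means two-sided ideal.\<close>

definition central_simple_algebra :: "('a, 'b) ring_scheme \<Rightarrow> 'a set \<Rightarrow> bool" where
  "central_simple_algebra A F \<longleftrightarrow>
     ring A \<and> subfield F A \<and> ring_center A = F \<and> ring.finite_dimension A F (carrier A) \<and>
     \<one>\<^bsub>A\<^esub> \<noteq> \<zero>\<^bsub>A\<^esub> \<and> (\<forall>I. ideal I A \<longrightarrow> I = {\<zero>\<^bsub>A\<^esub>} \<or> I = carrier A)"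

text \<open>
  A maximal subfield of a central simple algebra is one whose degree over \<open>F\<close> is the degree of
  the algebra, i.e. \<open>[A:F] = [K:F]\<^sup>2\<close>.  Maximality for inclusion among subfields is too weak
  when \<open>A\<close> has zero divisors, as the example of matrices over an algebraically closed
  field shows.
\<close>

definition maximal_subfield :: "('a, 'b) ring_scheme \<Rightarrow> 'a set \<Rightarrow> 'a set \<Rightarrow> bool" where
  "maximal_subfield A F K \<longleftrightarrow>
     subfield K A \<and> F \<subseteq> K \<and>
     (\<exists>n. ring.dimension A n F K \<and> ring.dimension A (n\<^sup>2) F (carrier A))"

text \<open>
  The data of \<open>(K/F, z, u, b)\<close>.  Indices run over \<open>{1..r}\<close>; values of \<open>\<sigma>\<close>, \<open>z\<close>, \<open>u\<close>, \<open>b\<close> and of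
  exponent vectors \<open>m\<close> at other indices are irrelevant.
\<close>

definition abelian_crossed_product ::
    "('a, 'b) ring_scheme \<Rightarrow> 'a set \<Rightarrow> 'a set \<Rightarrow> ('g, 'c) monoid_scheme \<Rightarrow> ('g \<Rightarrow> 'a \<Rightarrow> 'a) \<Rightarrow>
     nat \<Rightarrow> (nat \<Rightarrow> 'g) \<Rightarrow> (nat \<Rightarrow> 'a) \<Rightarrow> (nat \<Rightarrow> nat \<Rightarrow> 'a) \<Rightarrow> (nat \<Rightarrow> 'a) \<Rightarrow> bool" where
  "abelian_crossed_product A F K G \<phi> r \<sigma> z u b \<longleftrightarrow>
     central_simple_algebra A F \<and> maximal_subfield A F K \<and>
     (\<forall>i\<in>{1..r}. z i \<in> Units A \<and>
        (\<forall>k\<in>K. z i \<otimes>\<^bsub>A\<^esub> k \<otimes>\<^bsub>A\<^esub> inv\<^bsub>A\<^esub> (z i) = \<phi> (\<sigma> i) k)) \<and>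
     (\<forall>i\<in>{1..r}. \<forall>j\<in>{1..r}.
        u i j = z i \<otimes>\<^bsub>A\<^esub> z j \<otimes>\<^bsub>A\<^esub> inv\<^bsub>A\<^esub> (z i) \<otimes>\<^bsub>A\<^esub> inv\<^bsub>A\<^esub> (z j) \<and> u i j \<in> K - {\<zero>\<^bsub>A\<^esub>}) \<and>
     (\<forall>i\<in>{1..r}. b i = z i [^]\<^bsub>A\<^esub> group.ord G (\<sigma> i) \<and> b i \<in> K - {\<zero>\<^bsub>A\<^esub>})"

definition sigma_pow ::
    "('g, 'c) monoid_scheme \<Rightarrow> nat \<Rightarrow> (nat \<Rightarrow> 'g) \<Rightarrow> (nat \<Rightarrow> nat) \<Rightarrow> 'g" where
  "sigma_pow G r \<sigma> m = finprod G (\<lambda>i. \<sigma> i [^]\<^bsub>G\<^esub> m i) {1..r}"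

text \<open>The factors do not commute; they are multiplied in the order \<open>z 1, \<dots>, z r\<close>.\<close>

definition z_pow ::
    "('a, 'b) ring_scheme \<Rightarrow> nat \<Rightarrow> (nat \<Rightarrow> 'a) \<Rightarrow> (nat \<Rightarrow> nat) \<Rightarrow> 'a" where
  "z_pow A r z m = foldr (\<lambda>i y. z i [^]\<^bsub>A\<^esub> m i \<otimes>\<^bsub>A\<^esub> y) [1..<Suc r] \<one>\<^bsub>A\<^esub>"

definition u_pow ::
    "('a, 'b) ring_scheme \<Rightarrow> nat \<Rightarrow> (nat \<Rightarrow> 'a) \<Rightarrow> nat \<Rightarrow> (nat \<Rightarrow> nat) \<Rightarrow> 'a" where
  "u_pow A r z i m =
     z i \<otimes>\<^bsub>A\<^esub> z_pow A r z m \<otimes>\<^bsub>A\<^esub> inv\<^bsub>A\<^esub> (z i) \<otimes>\<^bsub>A\<^esub> inv\<^bsub>A\<^esub> (z_pow A r z m)"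

text \<open>
  Strong degeneracy of the matrix \<open>u\<close>.  It is expressed through the elements \<open>u_pow A r z i m\<close>,
  which depend on \<open>z\<close> only through the entries \<open>u i j\<close> and the action of \<open>G\<close> on \<open>K\<close>.
  Quotients in \<open>K\<close> are written with the inverse of \<open>A\<close>, which agrees with that of \<open>K\<close>.
\<close>

definition strongly_degenerate ::
    "('a, 'b) ring_scheme \<Rightarrow> 'a set \<Rightarrow> ('g, 'c) monoid_scheme \<Rightarrow> ('g \<Rightarrow> 'a \<Rightarrow> 'a) \<Rightarrow>
     nat \<Rightarrow> (nat \<Rightarrow> 'g) \<Rightarrow> (nat \<Rightarrow> 'a) \<Rightarrow> bool" where
  "strongly_degenerate A K G \<phi> r \<sigma> z \<longleftrightarrow>
     (\<exists>m :: nat \<Rightarrow> nat. Factorial_Ring.prime (group.ord G (sigma_pow G r \<sigma> m)) \<and>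
        (\<exists>l \<in> K - {\<zero>\<^bsub>A\<^esub>}. \<exists>x :: nat \<Rightarrow> 'a. (\<forall>i\<in>{1..r}. x i \<in> K - {\<zero>\<^bsub>A\<^esub>}) \<and>
           (\<forall>i\<in>{1..r}. u_pow A r z i m =
              (\<phi> (sigma_pow G r \<sigma> m) (x i) \<otimes>\<^bsub>A\<^esub> inv\<^bsub>A\<^esub> (x i)) \<otimes>\<^bsub>A\<^esub>
              (l \<otimes>\<^bsub>A\<^esub> inv\<^bsub>A\<^esub> (\<phi> (\<sigma> i) l)))))"

definition power_central :: "('a, 'b) ring_scheme \<Rightarrow> nat \<Rightarrow> 'a \<Rightarrow> bool" where
  "power_central A q y \<longleftrightarrow>
     y \<in> carrier A \<and> y \<notin> ring_center A \<and> y [^]\<^bsub>A\<^esub> q \<in> ring_center A"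

end

theory Submission
  imports Defs
begin

text \<open>
  Put \<open>y = l z\<^sup>m\<close> and let \<open>\<tau> = \<sigma>\<^sup>m\<close>, which is the automorphism of \<open>K\<close> induced by conjugation with
  \<open>y\<close>.  Then \<open>z\<^sub>i y = c\<^sub>i y z\<^sub>i\<close> with \<open>c\<^sub>i = \<sigma>\<^sub>i(l) u\<^sub>i\<^sub>,\<^sub>m / l\<close> in \<open>K\<close>, and strong degeneracy says that
  every \<open>c\<^sub>i\<close> has the form \<open>\<tau>(x\<^sub>i) / x\<^sub>i\<close>.  Raising to the power \<open>q\<close> gives
  \<open>z\<^sub>i y\<^sup>q = N(c\<^sub>i) y\<^sup>q z\<^sub>i\<close>, where \<open>N\<close> is the norm of \<open>\<tau>\<close> when \<open>\<tau>\<close> has order \<open>q\<close>.  If \<open>y\<^sup>q\<close> is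
  central, all these norms are \<open>1\<close> and Hilbert's Theorem 90 yields the \<open>x\<^sub>i\<close>.  Conversely,
  \<open>\<tau>\<^sup>q = 1\<close> forces \<open>y\<^sup>q\<close> into \<open>K\<close>, because modulo \<open>K\<^sup>*\<close> the \<open>z\<^sub>i\<close> commute and \<open>z\<^sub>i\<close> has order dividing
  that of \<open>\<sigma>\<^sub>i\<close>; being fixed by all \<open>\<sigma>\<^sub>i\<close>, it then lies in \<open>F\<close>.
\<close>

subsection \<open>Independence of characters and Hilbert's Theorem 90\<close>

text \<open>Artin's induction on the number of characters: subtracting a multiple of the relation at
  \<open>h\<close> from the relation at the product of \<open>g\<close> and \<open>h\<close> cancels
  the last character. \<open>\<chi>_one\<close> excludes the zero character, since membership in
  \<open>hom\<close> does not force the unit to be preserved.\<close>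

lemma (in domain) characters_independent:
  fixes n :: nat and \<chi> :: "nat \<Rightarrow> 'm \<Rightarrow> 'a" and a :: "nat \<Rightarrow> 'a"
  assumes H: "monoid H"
    and \<chi>: "\<And>i. i < n \<Longrightarrow> \<chi> i \<in> hom H R"
    and \<chi>_one: "\<And>i. i < n \<Longrightarrow> \<chi> i \<one>\<^bsub>H\<^esub> = \<one>"
    and distinct: "\<And>i j. i < j \<Longrightarrow> j < n \<Longrightarrow> \<exists>h\<in>carrier H. \<chi> i h \<noteq> \<chi> j h"
    and a: "\<And>i. i < n \<Longrightarrow> a i \<in> carrier R"
    and sum_zero: "\<And>h. h \<in> carrier H \<Longrightarrow> (\<Oplus>i\<in>{..<n}. a i \<otimes> \<chi> i h) = \<zero>"
    and "i < n"
  shows "a i = \<zero>"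
  using \<chi> \<chi>_one distinct a sum_zero \<open>i < n\<close>
proof (induction n arbitrary: a i)
  case 0
  then show ?case by simp
next
  case (Suc n)
  interpret H: monoid H by (rule H)
  have \<chi>_closed: "\<chi> j h \<in> carrier R" if "j < Suc n" "h \<in> carrier H" for j h
    using Suc.prems(1) that by (auto simp: hom_def)
  have \<chi>_mult: "\<chi> j (g \<otimes>\<^bsub>H\<^esub> h) = \<chi> j g \<otimes> \<chi> j h"
    if "j < Suc n" "g \<in> carrier H" "h \<in> carrier H" for j g h
    using Suc.prems(1) that by (auto simp: hom_def)
  have sum_Suc: "(\<Oplus>j\<in>{..<n}. a j \<otimes> \<chi> j h) = \<ominus> (a n \<otimes> \<chi> n h)" if h: "h \<in> carrier H" for h
  proof -
    have "a n \<otimes> \<chi> n h \<oplus> (\<Oplus>j\<in>{..<n}. a j \<otimes> \<chi> j h) = \<zero>"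
      using Suc.prems(5)[OF h] h Suc.prems(4) \<chi>_closed by (simp add: lessThan_Suc Pi_def)
    then show ?thesis
      using h Suc.prems(4) \<chi>_closed
      by (intro minus_equality[symmetric]) (auto simp: a_comm Pi_def)
  qed
  have zero: "a j = \<zero>" if j: "j < n" for j
  proof -
    obtain g where g: "g \<in> carrier H" "\<chi> j g \<noteq> \<chi> n g"
      using Suc.prems(3)[of j n] j by auto
    \<comment> \<open>These are the coefficients of the shorter relation. The element
      \<open>g\<close> is chosen for the single index \<open>j\<close>, where the factor
      \<open>\<chi> j g \<ominus> \<chi> n g\<close> is nonzero and can be cancelled.\<close>
    define a' where "a' i = a i \<otimes> (\<chi> i g \<ominus> \<chi> n g)" for i
    have "a' j = \<zero>"
    proof (rule Suc.IH)
      fix h assume h: "h \<in> carrier H"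
      have "(\<Oplus>i\<in>{..<n}. a' i \<otimes> \<chi> i h) =
          (\<Oplus>i\<in>{..<n}. a i \<otimes> \<chi> i (g \<otimes>\<^bsub>H\<^esub> h) \<oplus> (\<ominus> \<chi> n g) \<otimes> (a i \<otimes> \<chi> i h))"
      proof (intro finsum_cong)
        fix i
        have "b \<otimes> (x \<ominus> y) \<otimes> v = b \<otimes> (x \<otimes> v) \<oplus> (\<ominus> y) \<otimes> (b \<otimes> v)"
          if "b \<in> carrier R" "x \<in> carrier R" "y \<in> carrier R" "v \<in> carrier R" for b x y v
          using that by algebra
        then show "i \<in> {..<n} =simp=> a' i \<otimes> \<chi> i h =
            a i \<otimes> \<chi> i (g \<otimes>\<^bsub>H\<^esub> h) \<oplus> (\<ominus> \<chi> n g) \<otimes> (a i \<otimes> \<chi> i h)"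
          using g h Suc.prems(4) \<chi>_closed by (simp add: simp_implies_def a'_def \<chi>_mult)
      qed (use g h Suc.prems(4) \<chi>_closed in \<open>auto simp: a'_def\<close>)
      also have "\<dots> = (\<Oplus>i\<in>{..<n}. a i \<otimes> \<chi> i (g \<otimes>\<^bsub>H\<^esub> h)) \<oplus>
          (\<ominus> \<chi> n g) \<otimes> (\<Oplus>i\<in>{..<n}. a i \<otimes> \<chi> i h)"
        using g h Suc.prems(4) \<chi>_closed
        by (subst finsum_addf) (auto simp: finsum_rdistr Pi_def)
      also have "\<dots> = \<ominus> (a n \<otimes> (\<chi> n g \<otimes> \<chi> n h)) \<oplus> (\<ominus> \<chi> n g) \<otimes> (\<ominus> (a n \<otimes> \<chi> n h))"
        using g h \<chi>_mult by (simp add: sum_Suc)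
      also have "\<dots> = \<zero>"
      proof -
        have "a n \<in> carrier R" "\<chi> n g \<in> carrier R" "\<chi> n h \<in> carrier R"
          using g h Suc.prems(4) \<chi>_closed by auto
        then show ?thesis by algebra
      qed
      finally show "(\<Oplus>i\<in>{..<n}. a' i \<otimes> \<chi> i h) = \<zero>" .
    qed (use Suc.prems j g \<chi>_closed in \<open>auto simp: a'_def\<close>)
    moreover have "\<chi> j g \<ominus> \<chi> n g \<noteq> \<zero>"
      using g j \<chi>_closed by auto
    ultimately show ?thesis
      using integral[of "a j" "\<chi> j g \<ominus> \<chi> n g"] g j Suc.prems(4) \<chi>_closed by (auto simp: a'_def)
  qed
  \<comment> \<open>Only the last term of the relation survives; at the unit of \<open>H\<close> the
    character takes the value 1, so that term is \<open>a n\<close> itself.\<close>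
  have "a n = \<zero>"
  proof -
    have "(\<Oplus>j\<in>{..<n}. a j \<otimes> \<chi> j \<one>\<^bsub>H\<^esub>) = \<zero>"
      using zero \<chi>_closed by (intro add.finprod_one_eqI) simp
    then show ?thesis
      using sum_Suc[OF H.one_closed] Suc.prems(2,4) by simp
  qed
  with zero Suc.prems(6) show ?case
    by (cases "i = n") auto
qed

text \<open>
  The partial norm \<open>c \<tau>(c) \<dots> \<tau>\<^sup>n\<^sup>-\<^sup>1(c)\<close>.  Unlike a \<open>finprod\<close> it does not mention the carrier, so
  passing to a subring leaves it unchanged.
\<close>
primrec twisted_power :: "('a, 'b) ring_scheme \<Rightarrow> ('a \<Rightarrow> 'a) \<Rightarrow> 'a \<Rightarrow> nat \<Rightarrow> 'a" where
  "twisted_power R \<tau> c 0 = \<one>\<^bsub>R\<^esub>"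
| "twisted_power R \<tau> c (Suc n) = twisted_power R \<tau> c n \<otimes>\<^bsub>R\<^esub> (\<tau> ^^ n) c"

lemma twisted_power_carrier_update:
  "twisted_power (R\<lparr>carrier := K\<rparr>) \<tau> c n = twisted_power R \<tau> c n"
  by (induction n) auto

text \<open>\<open>period\<close> and \<open>order\<close> say that \<tau> has exact order
  \<open>q\<close>, so \<open>norm\<close> is the condition N(c) = 1 for the cyclic group generated
  by \<tau>. The solution is the inverse of a nonzero Lagrange resolvent \<open>s\<close> with c
  \<tau>(s) = s.\<close>

lemma (in field) hilbert_90:
  assumes \<tau>: "\<tau> \<in> ring_hom R R"
    and "q > 0"
    and period: "\<And>x. x \<in> carrier R \<Longrightarrow> (\<tau> ^^ q) x = x"
    and order: "\<And>j. 0 < j \<Longrightarrow> j < q \<Longrightarrow> \<exists>x\<in>carrier R. (\<tau> ^^ j) x \<noteq> x"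
    and c: "c \<in> carrier R"
    and norm: "twisted_power R \<tau> c q = \<one>"
  obtains x where "x \<in> carrier R - {\<zero>}" "c \<otimes> x = \<tau> x"
proof -
  define a where "a = twisted_power R \<tau> c"
  obtain p where p: "q = Suc p" using \<open>q > 0\<close> gr0_implies_Suc by blast
  have \<tau>_closed: "\<tau> x \<in> carrier R" if "x \<in> carrier R" for x
    using \<tau> that by (rule ring_hom_closed)
  have \<tau>_mult: "\<tau> (x \<otimes> y) = \<tau> x \<otimes> \<tau> y" if "x \<in> carrier R" "y \<in> carrier R" for x y
    using \<tau> that by (rule ring_hom_mult)
  have \<tau>_one: "\<tau> \<one> = \<one>" using \<tau> by (rule ring_hom_one)
  have funpow_closed: "(\<tau> ^^ j) x \<in> carrier R" if "x \<in> carrier R" for x j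
    using that by (induction j) (auto simp: \<tau>_closed)
  have funpow_mult: "(\<tau> ^^ j) (x \<otimes> y) = (\<tau> ^^ j) x \<otimes> (\<tau> ^^ j) y"
    if "x \<in> carrier R" "y \<in> carrier R" for x y j
    using that by (induction j) (auto simp: \<tau>_mult funpow_closed)
  have funpow_one: "(\<tau> ^^ j) \<one> = \<one>" for j
    by (induction j) (auto simp: \<tau>_one)
  have a_closed: "a j \<in> carrier R" for j
    unfolding a_def using c by (induction j) (auto simp: funpow_closed)
  have \<tau>_sum: "\<tau> (\<Oplus>j\<in>{..n}. f j) = (\<Oplus>j\<in>{..n}. \<tau> (f j))"
    if "\<And>j. f j \<in> carrier R" for f and n :: nat
    using that by (induction n) (auto simp: Pi_def \<tau>_closed ring_hom_add[OF \<tau>])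
  \<comment> \<open>The partial norms are shifted by one under the operator x \<mapsto> c \<tau>(x);
    hence so are the terms of the resolvent.\<close>
  have a_Suc: "c \<otimes> \<tau> (a j) = a (Suc j)" for j
  proof (induction j)
    case (Suc j)
    have "c \<otimes> \<tau> (a (Suc j)) = (c \<otimes> \<tau> (a j)) \<otimes> (\<tau> ^^ Suc j) c"
      using c a_closed funpow_closed \<tau>_closed
      by (simp add: a_def \<tau>_mult m_assoc)
    then show ?case by (simp add: Suc) (simp add: a_def)
  qed (use c in \<open>simp add: a_def \<tau>_one\<close>)
  \<comment> \<open>If the powers \<open>i\<close> and \<open>j\<close> of \<tau> agreed, applying
    the power \<open>q - i\<close> and using \<open>period\<close> would make the power
    \<open>j - i\<close> trivial, against \<open>order\<close>.\<close>
  have distinct: "\<exists>x\<in>carrier R. (\<tau> ^^ i) x \<noteq> (\<tau> ^^ j) x" if ij: "i < j" "j < q" for i j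
  proof (rule ccontr)
    assume "\<not> ?thesis"
    then have eq: "(\<tau> ^^ i) x = (\<tau> ^^ j) x" if "x \<in> carrier R" for x using that by blast
    obtain x where x: "x \<in> carrier R" "(\<tau> ^^ (j - i)) x \<noteq> x"
      using order[of "j - i"] ij less_imp_diff_less[of j q i] by auto
    have "(\<tau> ^^ (q - i)) ((\<tau> ^^ i) x) = (\<tau> ^^ (q - i)) ((\<tau> ^^ j) x)"
      using eq x by simp
    moreover have "(\<tau> ^^ (q - i)) ((\<tau> ^^ i) x) = (\<tau> ^^ q) x"
      using ij by (simp flip: comp_apply[where f = "_ ^^ _"] funpow_add)
    moreover have "(\<tau> ^^ (q - i)) ((\<tau> ^^ j) x) = (\<tau> ^^ q) ((\<tau> ^^ (j - i)) x)"
      using ij by (simp flip: comp_apply[where f = "_ ^^ _"] funpow_add)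
    ultimately show False
      using period[OF x(1)] period[OF funpow_closed[OF x(1)]] x(2) by metis
  qed
  \<comment> \<open>The operator \<open>x \<mapsto> c \<tau>(x)\<close> has \<open>q\<close>-th power \<open>1\<close>, so the sum of its first \<open>q\<close> powers,
    nonzero by independence of characters, maps into its fixed points.\<close>
  have "\<exists>k\<in>carrier R. (\<Oplus>j\<in>{..<q}. a j \<otimes> (\<tau> ^^ j) k) \<noteq> \<zero>"
  proof (rule ccontr)
    assume "\<not> ?thesis"
    then have "a 0 = \<zero>"
      using distinct a_closed \<open>q > 0\<close>
      by (intro characters_independent[of R q "\<lambda>j. \<tau> ^^ j" a])
        (auto simp: hom_def funpow_closed funpow_mult funpow_one monoid_axioms)
    then show False by (simp add: a_def)
  qed
  then obtain k where k: "k \<in> carrier R" and "(\<Oplus>j\<in>{..<q}. a j \<otimes> (\<tau> ^^ j) k) \<noteq> \<zero>" by blast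
  define f where "f j = a j \<otimes> (\<tau> ^^ j) k" for j
  define s where "s = (\<Oplus>j\<in>{..p}. f j)"
  have f_closed: "f j \<in> carrier R" for j
    using k by (simp add: f_def a_closed funpow_closed)
  have s: "s \<in> carrier R" "s \<noteq> \<zero>"
    using \<open>(\<Oplus>j\<in>{..<q}. a j \<otimes> (\<tau> ^^ j) k) \<noteq> \<zero>\<close> f_closed
    by (auto simp: s_def f_def p lessThan_Suc_atMost)
  \<comment> \<open>The index \<open>Suc p\<close> is \<open>q\<close>: there the coefficient is the
    full norm 1 and the power of \<tau> is the identity. The shift therefore permutes the terms of
    the sum cyclically.\<close>
  have "f (Suc p) = f 0"
    using norm period[OF k] k unfolding f_def a_def p by (simp del: funpow.simps twisted_power.simps(2))
  then have shift: "(\<Oplus>j\<in>{..p}. f (Suc j)) = s"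
    using add.finprod_Suc[of f p] add.finprod_Suc2[of f p] f_closed
    unfolding s_def by (simp add: a_comm Pi_def)
  have "c \<otimes> \<tau> s = (\<Oplus>j\<in>{..p}. c \<otimes> \<tau> (f j))"
    unfolding s_def using f_closed c by (simp add: \<tau>_sum finsum_rdistr \<tau>_closed Pi_def)
  also have "\<dots> = (\<Oplus>j\<in>{..p}. f (Suc j))"
  proof (intro finsum_cong)
    show "j \<in> {..p} =simp=> c \<otimes> \<tau> (f j) = f (Suc j)" for j
      using k c a_closed funpow_closed \<tau>_closed
      by (simp add: simp_implies_def f_def \<tau>_mult m_assoc[symmetric] a_Suc)
  qed (use c f_closed \<tau>_closed in auto)
  finally have cs: "c \<otimes> \<tau> s = s" by (simp add: shift)
  \<comment> \<open>Passing to inverses turns c \<tau>(s) = s into the required form \<tau>(x) = c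
    x.\<close>
  have inv_s: "inv s \<in> carrier R" "s \<otimes> inv s = \<one>" "inv s \<noteq> \<zero>"
    using s field_Units Units_r_inv[of s] Units_inv_closed[of s] Units_inv_Units[of s] by auto
  have "\<tau> s \<otimes> \<tau> (inv s) = \<one>"
    using \<tau>_mult[of s "inv s"] s inv_s \<tau>_one by simp
  then have "c \<otimes> \<tau> s \<otimes> \<tau> (inv s) = c"
    using s inv_s c \<tau>_closed by (simp add: m_assoc)
  then have "s \<otimes> \<tau> (inv s) = c" by (simp add: cs)
  then have "inv s \<otimes> (s \<otimes> \<tau> (inv s)) = inv s \<otimes> c" by simp
  then have "\<tau> (inv s) = c \<otimes> inv s"
    using s inv_s c \<tau>_closed by (simp add: m_assoc[symmetric] m_comm)
  then show thesis using that[of "inv s"] inv_s by simp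
qed

lemma (in cring) twisted_power_coboundary:
  assumes \<tau>: "\<tau> \<in> ring_hom R R" and x: "x \<in> carrier R" and c: "c \<in> carrier R"
    and eq: "c \<otimes> x = \<tau> x"
  shows "twisted_power R \<tau> c n \<otimes> x = (\<tau> ^^ n) x"
proof -
  have funpow_closed: "(\<tau> ^^ j) v \<in> carrier R" if "v \<in> carrier R" for v j
    using that by (induction j) (auto intro: ring_hom_closed[OF \<tau>])
  have funpow_mult: "(\<tau> ^^ j) (v \<otimes> w) = (\<tau> ^^ j) v \<otimes> (\<tau> ^^ j) w"
    if "v \<in> carrier R" "w \<in> carrier R" for v w j
    using that by (induction j) (auto simp: ring_hom_mult[OF \<tau>] funpow_closed)
  have tp_closed: "twisted_power R \<tau> c j \<in> carrier R" for j
    using c by (induction j) (auto simp: funpow_closed)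
  show ?thesis
  proof (induction n)
    case (Suc n)
    have "twisted_power R \<tau> c (Suc n) \<otimes> x = (\<tau> ^^ n) c \<otimes> (twisted_power R \<tau> c n \<otimes> x)"
      using x c tp_closed funpow_closed by (simp add: m_ac)
    also have "\<dots> = (\<tau> ^^ n) (\<tau> x)"
      using x c by (simp add: Suc funpow_mult[symmetric] eq)
    finally show ?case by (simp add: funpow_swap1)
  qed (use x in simp)
qed

subsection \<open>Units that normalize a subfield\<close>

lemma (in monoid) Units_r_cancel:
  assumes "u \<in> Units G" "a \<in> carrier G" "b \<in> carrier G" "a \<otimes> u = b \<otimes> u"
  shows "a = b"
proof -
  have "a \<otimes> u \<otimes> inv u = b \<otimes> u \<otimes> inv u" using assms(4) by simp
  then show ?thesis using assms(1-3) Units_closed by (simp add: m_assoc)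
qed

text \<open>The Galois data reduced to a faithful group action on a subfield of a possibly
  noncommutative ring. The axioms constrain the maps \<open>\<phi> g\<close> on \<open>K\<close>
  only.\<close>

locale galois_action = ring R + G: group G
  for R (structure) and K and G (structure) and \<phi> +
  assumes K: "subfield K R"
    and \<phi>_hom: "g \<in> carrier G \<Longrightarrow> \<phi> g \<in> ring_hom (R\<lparr>carrier := K\<rparr>) (R\<lparr>carrier := K\<rparr>)"
    and \<phi>_mult: "\<lbrakk>g \<in> carrier G; h \<in> carrier G; k \<in> K\<rbrakk> \<Longrightarrow> \<phi> (g \<otimes>\<^bsub>G\<^esub> h) k = \<phi> g (\<phi> h k)"
    and \<phi>_one: "k \<in> K \<Longrightarrow> \<phi> \<one>\<^bsub>G\<^esub> k = k"
    and faithful: "\<lbrakk>g \<in> carrier G; \<And>k. k \<in> K \<Longrightarrow> \<phi> g k = k\<rbrakk> \<Longrightarrow> g = \<one>\<^bsub>G\<^esub>"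
begin

section \<open>Arithmetic in K and the action on it\<close>

abbreviation L where "L \<equiv> R\<lparr>carrier := K\<rparr>"

sublocale L: field L
  by (rule subfield_iff(2)[OF K])

lemma K_subset: "k \<in> K \<Longrightarrow> k \<in> carrier R"
  using subfieldE(3)[OF K] by auto

lemma K_closed: "\<one> \<in> K" "\<lbrakk>k \<in> K; l \<in> K\<rbrakk> \<Longrightarrow> k \<otimes> l \<in> K"
  using L.one_closed L.m_closed[of k l] by auto

lemma K_comm: "\<lbrakk>k \<in> K; l \<in> K\<rbrakk> \<Longrightarrow> k \<otimes> l = l \<otimes> k"
  using L.m_comm[of k l] by auto

lemma K_unit:
  assumes "k \<in> K - {\<zero>}"
  shows "k \<in> Units R" "inv k \<in> K - {\<zero>}" "k \<otimes> inv k = \<one>" "inv k \<otimes> k = \<one>"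
  using subfield_m_inv[OF K assms] assms unfolding Units_def by (auto intro!: bexI[of _ "inv k"] simp: K_subset)

lemma K_unit_mult: "\<lbrakk>k \<in> K - {\<zero>}; l \<in> K - {\<zero>}\<rbrakk> \<Longrightarrow> k \<otimes> l \<in> K - {\<zero>}"
  using L.integral[of k l] L.m_closed[of k l] by auto

lemma K_unit_one: "\<one> \<in> K - {\<zero>}"
  using L.one_not_zero K_closed by auto

lemma K_unit_pow: "k \<in> K - {\<zero>} \<Longrightarrow> k [^] (n :: nat) \<in> K - {\<zero>}"
  using K_unit_one K_unit_mult by (induction n) auto

lemma \<phi>_closed: "\<lbrakk>g \<in> carrier G; k \<in> K\<rbrakk> \<Longrightarrow> \<phi> g k \<in> K"
  using ring_hom_closed[OF \<phi>_hom] by auto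

lemma \<phi>_unit:
  assumes g: "g \<in> carrier G" and k: "k \<in> K - {\<zero>}"
  shows "\<phi> g k \<in> K - {\<zero>}"
proof -
  have "\<phi> g k \<otimes> \<phi> g (inv k) = \<one>"
    using ring_hom_mult[OF \<phi>_hom[OF g], of k "inv k"] ring_hom_one[OF \<phi>_hom[OF g]] K_unit[OF k] k
    by auto
  then have "\<phi> g k \<noteq> \<zero>"
    using \<phi>_closed[OF g, of "inv k"] K_unit[OF k] K_unit_one K_subset by auto
  then show ?thesis using \<phi>_closed g k by auto
qed

lemma \<phi>_pow:
  assumes "g \<in> carrier G" "k \<in> K"
  shows "\<phi> (g [^]\<^bsub>G\<^esub> n) k = (\<phi> g ^^ n) k"
  using assms
proof (induction n arbitrary: k)
  case (Suc n)
  then show ?case using \<phi>_mult[of "g [^]\<^bsub>G\<^esub> n" g k] \<phi>_closed by (simp add: funpow_swap1)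
qed (simp add: \<phi>_one)

text \<open>Conjugation by the unit \<open>w\<close> restricts to \<open>\<phi> g\<close> on
  \<open>K\<close>. With the inverse cleared, the condition is a rule for pushing scalars to the
  left.\<close>

definition acts :: "'a \<Rightarrow> 'c \<Rightarrow> bool" where
  "acts w g \<longleftrightarrow> w \<in> Units R \<and> g \<in> carrier G \<and> (\<forall>k\<in>K. w \<otimes> k = \<phi> g k \<otimes> w)"

text \<open>For units this says that the commutator lies in K*, so that the classes modulo K*
  commute.\<close>

definition commutes_mod_K :: "'a \<Rightarrow> 'a \<Rightarrow> bool" where
  "commutes_mod_K w v \<longleftrightarrow> (\<exists>c\<in>K - {\<zero>}. w \<otimes> v = c \<otimes> (v \<otimes> w))"

section \<open>Products and powers of units acting on K\<close>

lemma actsD: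
  assumes "acts w g"
  shows "w \<in> Units R" "w \<in> carrier R" "g \<in> carrier G" "k \<in> K \<Longrightarrow> w \<otimes> k = \<phi> g k \<otimes> w"
  using assms by (auto simp: acts_def)

lemma acts_move:
  assumes "acts w g" "k \<in> K" "v \<in> carrier R"
  shows "w \<otimes> (k \<otimes> v) = \<phi> g k \<otimes> (w \<otimes> v)"
  using assms actsD[OF assms(1)] K_subset \<phi>_closed by (simp flip: m_assoc)

lemma acts_one: "acts \<one> \<one>\<^bsub>G\<^esub>"
  by (auto simp: acts_def \<phi>_one K_subset)

lemma acts_K: "l \<in> K - {\<zero>} \<Longrightarrow> acts l \<one>\<^bsub>G\<^esub>"
  using K_unit(1) by (auto simp: acts_def \<phi>_one K_comm)

lemma acts_mult:
  assumes w: "acts w g" and v: "acts v h"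
  shows "acts (w \<otimes> v) (g \<otimes>\<^bsub>G\<^esub> h)"
  using actsD[OF w] actsD[OF v] K_subset \<phi>_closed
  by (auto simp: acts_def m_assoc \<phi>_mult acts_move[OF w])

lemma acts_pow: "acts w g \<Longrightarrow> acts (w [^] (n :: nat)) (g [^]\<^bsub>G\<^esub> n)"
  by (induction n) (auto simp: acts_one acts_mult)

text \<open>Faithfulness read through conjugation. It shows that \<tau> is trivial if
  \<open>y\<close> is central, and that the q-th power of \<tau> is trivial if that of
  \<open>y\<close> is central.\<close>

lemma acts_trivially:
  assumes "acts w g" and comm: "\<And>k. k \<in> K \<Longrightarrow> w \<otimes> k = k \<otimes> w"
  shows "g = \<one>\<^bsub>G\<^esub>"
proof (rule faithful)
  fix k assume k: "k \<in> K"
  have "\<phi> g k \<otimes> w = k \<otimes> w" using actsD(4)[OF assms(1) k] comm[OF k] by simp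
  then show "\<phi> g k = k"
    using actsD[OF assms(1)] K_subset \<phi>_closed k by (auto intro: Units_r_cancel)
qed (use actsD[OF assms(1)] in auto)

text \<open>Moving \<open>w\<close> past the second factor leaves a scalar behind \<open>v\<close>;
  carrying it to the front through \<open>v\<close> applies \<open>\<phi> h\<close>, which keeps it
  in K*.\<close>

lemma commutes_mod_K_mult_right:
  assumes "acts w g" and v: "acts v h" and v': "acts v' h'"
    and "commutes_mod_K w v" "commutes_mod_K w v'"
  shows "commutes_mod_K w (v \<otimes> v')"
proof -
  note w = \<open>acts w g\<close>
  obtain c c' where c: "c \<in> K - {\<zero>}" "w \<otimes> v = c \<otimes> (v \<otimes> w)"
    and c': "c' \<in> K - {\<zero>}" "w \<otimes> v' = c' \<otimes> (v' \<otimes> w)"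
    using assms(4,5) by (auto simp: commutes_mod_K_def)
  have carr: "w \<in> carrier R" "v \<in> carrier R" "v' \<in> carrier R" "c \<in> carrier R" "c' \<in> carrier R"
    "\<phi> h c' \<in> carrier R"
    using actsD[OF w] actsD[OF v] actsD[OF v'] c c' K_subset \<phi>_closed by auto
  have "w \<otimes> (v \<otimes> v') = c \<otimes> (v \<otimes> (w \<otimes> v'))"
    using carr c by (simp flip: m_assoc)
  also have "\<dots> = c \<otimes> (\<phi> h c' \<otimes> (v \<otimes> (v' \<otimes> w)))"
    using carr c' by (simp add: acts_move[OF v])
  also have "\<dots> = (c \<otimes> \<phi> h c') \<otimes> (v \<otimes> v' \<otimes> w)"
    using carr by (simp add: m_assoc)
  finally show ?thesis
    using K_unit_mult[OF c(1) \<phi>_unit[OF actsD(3)[OF v] c'(1)]]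
    unfolding commutes_mod_K_def by blast
qed

lemma commutes_mod_K_sym:
  assumes w: "acts w g" and v: "acts v h" and "commutes_mod_K w v"
  shows "commutes_mod_K v w"
proof -
  obtain c where c: "c \<in> K - {\<zero>}" "w \<otimes> v = c \<otimes> (v \<otimes> w)"
    using assms(3) by (auto simp: commutes_mod_K_def)
  have "v \<otimes> w = inv c \<otimes> (w \<otimes> v)"
    using c K_unit[OF c(1)] K_subset actsD[OF w] actsD[OF v] by (simp flip: m_assoc)
  then show ?thesis
    using K_unit[OF c(1)] by (auto simp: commutes_mod_K_def)
qed

lemma commutes_mod_K_one_right:
  "acts w g \<Longrightarrow> commutes_mod_K w \<one>"
  using actsD(2) K_unit_one by (auto simp: commutes_mod_K_def intro!: bexI[of _ \<one>])

lemma commutes_mod_K_pow_right: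
  assumes "acts w g" "acts v h" "commutes_mod_K w v"
  shows "commutes_mod_K w (v [^] (n :: nat))"
  using assms by (induction n) (auto intro: commutes_mod_K_one_right commutes_mod_K_mult_right acts_pow)

lemma commutes_mod_K_pow_left:
  assumes "acts w g" "acts v h" "commutes_mod_K w v"
  shows "commutes_mod_K (w [^] (n :: nat)) v"
  by (meson assms acts_pow commutes_mod_K_pow_right commutes_mod_K_sym)

text \<open>The classes of \<open>w\<close> and \<open>v\<close> modulo K* commute, so powers
  distribute over the product; the induction collects the scalars on the left.\<close>

lemma pow_mult_mod_K:
  assumes w: "acts w g" and v: "acts v h" and "commutes_mod_K w v"
  obtains c where "c \<in> K - {\<zero>}" "(w \<otimes> v) [^] (n :: nat) = c \<otimes> (w [^] n \<otimes> v [^] n)"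
proof -
  have "\<exists>c\<in>K - {\<zero>}. (w \<otimes> v) [^] n = c \<otimes> (w [^] n \<otimes> v [^] n)"
  proof (induction n)
    case 0
    then show ?case using K_unit_one by (intro bexI[of _ \<one>]) auto
  next
    case (Suc n)
    then obtain c where c: "c \<in> K - {\<zero>}" "(w \<otimes> v) [^] n = c \<otimes> (w [^] n \<otimes> v [^] n)" by blast
    \<comment> \<open>The scalar \<open>d\<close> is the cost of this exchange; moving it in front
      of \<open>w [^] n\<close> turns it into \<open>?e\<close>.\<close>
    obtain d where d: "d \<in> K - {\<zero>}" "v [^] n \<otimes> w = d \<otimes> (w \<otimes> v [^] n)"
      using commutes_mod_K_pow_left[OF v w commutes_mod_K_sym[OF w v assms(3)], of n]
      by (auto simp: commutes_mod_K_def)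
    let ?e = "\<phi> (g [^]\<^bsub>G\<^esub> n) d"
    have e: "?e \<in> K - {\<zero>}" using \<phi>_unit d actsD[OF w] by auto
    have carr: "w \<in> carrier R" "v \<in> carrier R" "c \<in> carrier R" "d \<in> carrier R" "?e \<in> carrier R"
      using actsD[OF w] actsD[OF v] c d e K_subset by auto
    have "(w \<otimes> v) [^] Suc n = c \<otimes> (w [^] n \<otimes> ((v [^] n \<otimes> w) \<otimes> v))"
      using carr by (simp add: c m_assoc)
    also have "\<dots> = c \<otimes> (w [^] n \<otimes> (d \<otimes> (w \<otimes> v [^] n \<otimes> v)))"
      using carr by (simp add: d m_assoc)
    also have "\<dots> = c \<otimes> (?e \<otimes> (w [^] n \<otimes> (w \<otimes> v [^] n \<otimes> v)))"
      using carr d by (simp add: acts_move[OF acts_pow[OF w]])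
    also have "\<dots> = (c \<otimes> ?e) \<otimes> (w [^] Suc n \<otimes> v [^] Suc n)"
      using carr by (simp add: m_assoc)
    finally show ?case using K_unit_mult[OF c(1) e] by blast
  qed
  then show thesis using that by blast
qed

lemma pow_mult_in_K:
  assumes "acts w g" "acts v h" "commutes_mod_K w v"
    and "w [^] (n :: nat) \<in> K - {\<zero>}" "v [^] n \<in> K - {\<zero>}"
  shows "(w \<otimes> v) [^] n \<in> K - {\<zero>}"
  using pow_mult_mod_K[OF assms(1-3), of n] K_unit_mult assms(4,5) by metis

text \<open>Each copy of \<open>y\<close> that \<open>w\<close> passes contributes a factor
  \<open>c\<close>, and moving that factor to the front past \<open>j\<close> copies of
  \<open>y\<close> applies \<tau> to it \<open>j\<close> times. The product is the partial norm of
  \<open>c\<close>.\<close>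

lemma twist_pow:
  assumes y: "acts y \<tau>" and w: "w \<in> carrier R" and c: "c \<in> K"
    and eq: "w \<otimes> y = c \<otimes> (y \<otimes> w)"
  shows "twisted_power R (\<phi> \<tau>) c n \<in> K"
    and "w \<otimes> y [^] n = twisted_power R (\<phi> \<tau>) c n \<otimes> (y [^] n \<otimes> w)"
proof -
  note [simp] = actsD(2,3)[OF y]
  have tp: "twisted_power R (\<phi> \<tau>) c n \<in> K" for n
    using c by (induction n) (auto simp: K_closed \<phi>_closed simp flip: \<phi>_pow)
  show "twisted_power R (\<phi> \<tau>) c n \<in> K" by (rule tp)
  show "w \<otimes> y [^] n = twisted_power R (\<phi> \<tau>) c n \<otimes> (y [^] n \<otimes> w)"
  proof (induction n)
    case (Suc n)
    let ?t = "twisted_power R (\<phi> \<tau>) c n" and ?d = "(\<phi> \<tau> ^^ n) c"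
    have d: "?d \<in> K" using c by (simp add: \<phi>_closed flip: \<phi>_pow)
    note carr = w K_subset[OF c] K_subset[OF tp[of n]] K_subset[OF d]
    have "w \<otimes> y [^] Suc n = ?t \<otimes> (y [^] n \<otimes> w) \<otimes> y"
      using carr by (simp add: Suc flip: m_assoc)
    also have "\<dots> = ?t \<otimes> (y [^] n \<otimes> (c \<otimes> (y \<otimes> w)))"
      using carr by (simp add: m_assoc eq)
    also have "\<dots> = ?t \<otimes> (?d \<otimes> (y [^] n \<otimes> (y \<otimes> w)))"
      using carr c by (simp add: acts_move[OF acts_pow[OF y]] \<phi>_pow)
    finally show ?case using carr by (simp add: m_assoc)
  qed (use w in simp)
qed

end

subsection \<open>Abelian crossed products\<close>

text \<open>The crossed product as the proof uses it: \<open>z_commute\<close> carries the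
  information of \<open>u\<close>, \<open>z_pow_ord\<close> that of \<open>b\<close>,
  \<open>\<sigma>_independent\<close> is directness of the product of the cyclic subgroups, and
  \<open>center\<close> identifies F with the common fixed field of the
  \<open>\<sigma> i\<close>.\<close>

locale abelian_crossing = galois_action R K G \<phi> + G: comm_group G
  for R (structure) and K and G (structure) and \<phi> +
  fixes r :: nat and \<sigma> :: "nat \<Rightarrow> 'c" and z :: "nat \<Rightarrow> 'a"
  assumes z_acts: "i \<in> {1..r} \<Longrightarrow> acts (z i) (\<sigma> i)"
    and z_commute: "\<lbrakk>i \<in> {1..r}; j \<in> {1..r}\<rbrakk> \<Longrightarrow> commutes_mod_K (z i) (z j)"
    and z_pow_ord: "i \<in> {1..r} \<Longrightarrow> z i [^] G.ord (\<sigma> i) \<in> K - {\<zero>}"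
    and \<sigma>_independent:
      "\<lbrakk>sigma_pow G r \<sigma> m = \<one>\<^bsub>G\<^esub>; i \<in> {1..r}\<rbrakk> \<Longrightarrow> \<sigma> i [^]\<^bsub>G\<^esub> m i = \<one>\<^bsub>G\<^esub>"
    and center: "ring_center R = {k \<in> K. \<forall>i\<in>{1..r}. \<phi> (\<sigma> i) k = k}"
begin

section \<open>Monomials in the z i and the automorphisms they induce\<close>

lemma \<sigma>_closed: "i \<in> {1..r} \<Longrightarrow> \<sigma> i \<in> carrier G"
  using actsD(3)[OF z_acts] .

lemma z_closed: "i \<in> {1..r} \<Longrightarrow> z i \<in> carrier R"
  using actsD(2)[OF z_acts] .

text \<open>Arbitrary lists of indices let the induction follow the \<open>foldr\<close> of
  \<open>z_pow\<close>; distinctness matches the ordered product with the \<open>finprod\<close>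
  over the set of entries.\<close>

lemma z_list_acts:
  "\<lbrakk>distinct xs; set xs \<subseteq> {1..r}\<rbrakk> \<Longrightarrow>
    acts (foldr (\<lambda>i y. z i [^] (m i :: nat) \<otimes> y) xs \<one>) (finprod G (\<lambda>i. \<sigma> i [^]\<^bsub>G\<^esub> m i) (set xs))"
proof (induction xs)
  case (Cons i xs)
  then have "finprod G (\<lambda>i. \<sigma> i [^]\<^bsub>G\<^esub> m i) (set (i # xs)) =
      \<sigma> i [^]\<^bsub>G\<^esub> m i \<otimes>\<^bsub>G\<^esub> finprod G (\<lambda>i. \<sigma> i [^]\<^bsub>G\<^esub> m i) (set xs)"
    by (simp, subst G.finprod_insert) (auto simp: \<sigma>_closed)
  with Cons show ?case by (auto intro!: acts_mult acts_pow z_acts)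
qed (simp add: acts_one)

lemma z_list_commutes:
  assumes "acts w g" "\<And>i. i \<in> set xs \<Longrightarrow> commutes_mod_K w (z i)"
    and "distinct xs" "set xs \<subseteq> {1..r}"
  shows "commutes_mod_K w (foldr (\<lambda>i y. z i [^] (m i :: nat) \<otimes> y) xs \<one>)"
  using assms
proof (induction xs)
  case (Cons i xs)
  show ?case
    unfolding foldr.simps comp_apply
  proof (rule commutes_mod_K_mult_right[OF Cons.prems(1) acts_pow[OF z_acts] z_list_acts])
    show "commutes_mod_K w (z i [^] m i)"
      using Cons.prems by (intro commutes_mod_K_pow_right[OF _ z_acts]) auto
  qed (use Cons in auto)
qed (simp add: commutes_mod_K_one_right)

text \<open>Modulo K* the factors commute, so the q-th power of the monomial is the product of the
  q-th powers of its factors.\<close>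

lemma z_list_pow_in_K:
  fixes q :: nat
  assumes "\<And>i. i \<in> set xs \<Longrightarrow> z i [^] (m i * q) \<in> K - {\<zero>}"
    and "distinct xs" "set xs \<subseteq> {1..r}"
  shows "foldr (\<lambda>i y. z i [^] (m i :: nat) \<otimes> y) xs \<one> [^] q \<in> K - {\<zero>}"
  using assms
proof (induction xs)
  case (Cons i xs)
  show ?case
    unfolding foldr.simps comp_apply
  proof (rule pow_mult_in_K[OF acts_pow[OF z_acts] z_list_acts])
    show "commutes_mod_K (z i [^] m i) (foldr (\<lambda>i y. z i [^] m i \<otimes> y) xs \<one>)"
      using Cons.prems
      by (intro commutes_mod_K_pow_left[OF z_acts z_list_acts] z_list_commutes[OF z_acts])
        (auto intro!: z_commute)
    show "(z i [^] m i) [^] q \<in> K - {\<zero>}"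
      using Cons.prems z_closed[of i] by (simp add: nat_pow_pow)
  qed (use Cons in auto)
qed (use K_unit_one in simp)

lemma z_pow_acts: "acts (z_pow R r z m) (sigma_pow G r \<sigma> m)"
  using z_list_acts[of "[1..<Suc r]" m]
  by (simp add: z_pow_def sigma_pow_def atLeastLessThanSuc_atLeastAtMost del: upt_Suc)

lemma sigma_pow_closed: "sigma_pow G r \<sigma> m \<in> carrier G"
  using actsD(3)[OF z_pow_acts] .

lemma u_pow_unit:
  assumes i: "i \<in> {1..r}"
  shows "u_pow R r z i m \<in> K - {\<zero>}"
    and "z i \<otimes> z_pow R r z m = u_pow R r z i m \<otimes> (z_pow R r z m \<otimes> z i)"
proof -
  let ?Z = "z_pow R r z m"
  have "commutes_mod_K (z i) ?Z"
    unfolding z_pow_def by (rule z_list_commutes[OF z_acts[OF i]]) (use i in \<open>auto intro!: z_commute\<close>)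
  then obtain c where c: "c \<in> K - {\<zero>}" "z i \<otimes> ?Z = c \<otimes> (?Z \<otimes> z i)"
    by (auto simp: commutes_mod_K_def)
  note units = actsD(1)[OF z_pow_acts[of m]] actsD(1)[OF z_acts[OF i]]
  have "u_pow R r z i m = c \<otimes> (?Z \<otimes> (z i \<otimes> inv (z i)) \<otimes> inv ?Z)"
    unfolding u_pow_def c(2)
    using units[THEN Units_closed] units[THEN Units_inv_closed] K_subset[of c] c(1)
    by (simp only: m_assoc m_closed DiffD1)
  also have "\<dots> = c" using units c K_subset Units_closed[OF units(1)] by simp
  finally show "u_pow R r z i m \<in> K - {\<zero>}" "z i \<otimes> ?Z = u_pow R r z i m \<otimes> (?Z \<otimes> z i)"
    using c by auto
qed

lemma sigma_pow_pow: "sigma_pow G r \<sigma> m [^]\<^bsub>G\<^esub> (q :: nat) = sigma_pow G r \<sigma> (\<lambda>i. m i * q)"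
proof -
  have "finprod G (\<lambda>i. \<sigma> i [^]\<^bsub>G\<^esub> m i) A [^]\<^bsub>G\<^esub> q = finprod G (\<lambda>i. \<sigma> i [^]\<^bsub>G\<^esub> (m i * q)) A"
    if "A \<subseteq> {1..r}" for A
  proof -
    have "finite A" using that finite_subset by blast
    then show ?thesis using that
      by induction (auto simp: \<sigma>_closed G.nat_pow_distrib G.nat_pow_pow Pi_def subset_iff)
  qed
  then show ?thesis by (simp add: sigma_pow_def)
qed

section \<open>The element l z^m and its commutation with the generators\<close>

context
  fixes l m y \<tau>
  assumes l: "l \<in> K - {\<zero>}"
  defines "y \<equiv> l \<otimes> z_pow R r z m" and "\<tau> \<equiv> sigma_pow G r \<sigma> m"
begin

lemma \<tau>_closed: "\<tau> \<in> carrier G"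
  unfolding \<tau>_def by (rule sigma_pow_closed)

lemma y_acts: "acts y \<tau>"
  using acts_mult[OF acts_K[OF l] z_pow_acts[of m]] sigma_pow_closed[of m]
  by (simp add: y_def \<tau>_def)

text \<open>The commutator of \<open>z i\<close> and \<open>y\<close>: the factor called
  \<open>c\<^sub>i\<close> in the outline.\<close>

definition twist :: "nat \<Rightarrow> 'a" where
  "twist i = \<phi> (\<sigma> i) l \<otimes> u_pow R r z i m \<otimes> inv l"

lemma twist:
  assumes i: "i \<in> {1..r}"
  shows "twist i \<in> K - {\<zero>}" and "z i \<otimes> y = twist i \<otimes> (y \<otimes> z i)"
proof -
  let ?Z = "z_pow R r z m" and ?u = "u_pow R r z i m" and ?s = "\<phi> (\<sigma> i) l"
  have s: "?s \<in> K - {\<zero>}" using \<phi>_unit[OF \<sigma>_closed[OF i] l] .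
  note u = u_pow_unit[OF i, of m]
  show "twist i \<in> K - {\<zero>}"
    unfolding twist_def using s u K_unit[OF l] by (intro K_unit_mult)
  have carr: "?s \<in> carrier R" "?u \<in> carrier R" "inv l \<in> carrier R" "l \<in> carrier R"
    "?Z \<in> carrier R" "z i \<in> carrier R"
    using s u(1) K_unit[OF l] l K_subset actsD[OF z_pow_acts[of m]] z_closed[OF i] by auto
  have "z i \<otimes> y = ?s \<otimes> (?u \<otimes> (?Z \<otimes> z i))"
    unfolding y_def using l carr by (simp add: acts_move[OF z_acts[OF i]] u(2))
  \<comment> \<open>Inserting this 1 completes \<open>?Z\<close> to \<open>y\<close> and leaves
    \<open>inv l\<close> as the last factor of the twist.\<close>
  also have "\<dots> = ?s \<otimes> (?u \<otimes> ((inv l \<otimes> l) \<otimes> (?Z \<otimes> z i)))"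
    using carr K_unit[OF l] by simp
  also have "\<dots> = twist i \<otimes> (y \<otimes> z i)"
    unfolding twist_def y_def using carr by (simp only: m_assoc m_closed)
  finally show "z i \<otimes> y = twist i \<otimes> (y \<otimes> z i)" .
qed

text \<open>Clearing denominators in the field \<open>K\<close>: the factors involving
  \<open>l\<close> move to the other side and complete the entry of \<open>u\<close> to the
  twist.\<close>

lemma degeneracy_iff_twist:
  assumes i: "i \<in> {1..r}" and x: "x \<in> K - {\<zero>}"
  shows "u_pow R r z i m = (\<phi> \<tau> x \<otimes> inv x) \<otimes> (l \<otimes> inv (\<phi> (\<sigma> i) l)) \<longleftrightarrow>
    twist i \<otimes> x = \<phi> \<tau> x"
proof -
  let ?u = "u_pow R r z i m" and ?s = "\<phi> (\<sigma> i) l" and ?t = "\<phi> \<tau> x"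
  have s: "?s \<in> K - {\<zero>}" using \<phi>_unit[OF \<sigma>_closed[OF i] l] .
  have K: "?u \<in> K" "?s \<in> K" "?t \<in> K" "x \<in> K" "l \<in> K" "inv x \<in> K" "inv ?s \<in> K" "inv l \<in> K"
    using s l x u_pow_unit[OF i, of m] \<phi>_closed[OF \<tau>_closed] K_unit[OF s] K_unit[OF l] K_unit[OF x]
    by auto
  note carr = K[THEN K_subset]
  \<comment> \<open>The ambient ring is not commutative, so the permutation rules for ordered
    rewriting carry membership in \<open>K\<close> as a condition.\<close>
  have comm: "a \<otimes> b = b \<otimes> a" "a \<otimes> (b \<otimes> c) = b \<otimes> (a \<otimes> c)"
    if "a \<in> K" "b \<in> K" "c \<in> K" for a b c
    using L.m_comm[of a b] L.m_lcomm[of a b c] that by auto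
  show ?thesis
  proof
    assume u: "?u = (?t \<otimes> inv x) \<otimes> (l \<otimes> inv ?s)"
    have "twist i \<otimes> x = ?t \<otimes> ((?s \<otimes> inv ?s) \<otimes> ((l \<otimes> inv l) \<otimes> (x \<otimes> inv x)))"
      unfolding twist_def u using K by (simp only: K_closed comm m_assoc carr m_closed)
    also have "\<dots> = ?t" using K_unit[OF s] K_unit[OF l] K_unit[OF x] carr by simp
    finally show "twist i \<otimes> x = ?t" .
  next
    assume t: "twist i \<otimes> x = ?t"
    have "(?t \<otimes> inv x) \<otimes> (l \<otimes> inv ?s) =
        ?u \<otimes> ((?s \<otimes> inv ?s) \<otimes> ((l \<otimes> inv l) \<otimes> (x \<otimes> inv x)))"
      unfolding twist_def t[symmetric] using K by (simp only: K_closed comm m_assoc carr m_closed)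
    also have "\<dots> = ?u" using K_unit[OF s] K_unit[OF l] K_unit[OF x] carr by simp
    finally show "?u = (?t \<otimes> inv x) \<otimes> (l \<otimes> inv ?s)" ..
  qed
qed

text \<open>By independence of the basis each \<open>\<sigma> i [^] (m i * q)\<close> is trivial, so
  the order of \<open>\<sigma> i\<close> divides \<open>m i * q\<close> and the corresponding power
  of \<open>z i\<close> is a power of \<open>b i\<close>.\<close>

lemma y_pow_in_K:
  assumes "\<tau> [^]\<^bsub>G\<^esub> (q :: nat) = \<one>\<^bsub>G\<^esub>"
  shows "y [^] q \<in> K - {\<zero>}"
proof -
  have "z i [^] (m i * q) \<in> K - {\<zero>}" if i: "i \<in> {1..r}" for i
  proof -
    have "\<sigma> i [^]\<^bsub>G\<^esub> (m i * q) = \<one>\<^bsub>G\<^esub>"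
      using \<sigma>_independent[of "\<lambda>i. m i * q"] i assms by (simp add: \<tau>_def sigma_pow_pow)
    then obtain k where k: "m i * q = G.ord (\<sigma> i) * k"
      using G.pow_eq_id[OF \<sigma>_closed[OF i]] by auto
    show ?thesis
      unfolding k nat_pow_pow[OF z_closed[OF i], symmetric] by (rule K_unit_pow[OF z_pow_ord[OF i]])
  qed
  then have "z_pow R r z m [^] q \<in> K - {\<zero>}"
    unfolding z_pow_def by (intro z_list_pow_in_K) auto
  \<comment> \<open>The commutator is l/\<tau>(l), which allows the q-th power of the product to be
    split modulo K*.\<close>
  moreover have "commutes_mod_K l (z_pow R r z m)"
  proof -
    let ?Z = "z_pow R r z m"
    have "inv (\<phi> \<tau> l) \<in> K - {\<zero>}"
      using K_unit(2) \<phi>_unit[OF \<tau>_closed l] by blast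
    then have "l \<otimes> inv (\<phi> \<tau> l) \<in> K - {\<zero>}" using l K_unit_mult by blast
    moreover have "l \<otimes> ?Z = (l \<otimes> inv (\<phi> \<tau> l)) \<otimes> (?Z \<otimes> l)"
      using l actsD[OF z_pow_acts[of m]] K_unit[OF \<phi>_unit[OF \<tau>_closed l]] \<phi>_unit[OF \<tau>_closed l] K_subset
      by (simp add: \<tau>_def m_assoc) (simp flip: m_assoc)
    ultimately show ?thesis unfolding commutes_mod_K_def by blast
  qed
  ultimately show ?thesis
    unfolding y_def using pow_mult_in_K[OF acts_K[OF l] z_pow_acts[of m]] K_unit_pow[OF l] by blast
qed

lemma noncentral: "\<tau> \<noteq> \<one>\<^bsub>G\<^esub> \<Longrightarrow> y \<notin> ring_center R"
  using acts_trivially[OF y_acts] K_subset by (auto simp: ring_center_def)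

text \<open>The norm of a coboundary is 1, so the q-th power of \<open>y\<close> commutes with every
  \<open>z i\<close>. Since it lies in \<open>K\<close>, it is fixed by every
  \<open>\<sigma> i\<close> and hence central.\<close>

lemma twist_coboundary_imp_power_central:
  assumes "Factorial_Ring.prime (G.ord \<tau>)"
    and x: "\<And>i. i \<in> {1..r} \<Longrightarrow> x i \<in> K - {\<zero>} \<and> twist i \<otimes> x i = \<phi> \<tau> (x i)"
  shows "power_central R (G.ord \<tau>) y"
proof -
  let ?q = "G.ord \<tau>"
  have \<tau>_pow: "\<tau> [^]\<^bsub>G\<^esub> ?q = \<one>\<^bsub>G\<^esub>" by (simp add: G.pow_ord_eq_1 \<tau>_closed)
  have yq: "y [^] ?q \<in> K" using y_pow_in_K[OF \<tau>_pow] by simp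
  have "\<phi> (\<sigma> i) (y [^] ?q) = y [^] ?q" if i: "i \<in> {1..r}" for i
  proof -
    let ?t = "twisted_power R (\<phi> \<tau>) (twist i) ?q"
    have xi: "x i \<in> K - {\<zero>}" "twist i \<otimes> x i = \<phi> \<tau> (x i)" using x[OF i] by auto
    have "?t \<otimes> x i = (\<phi> \<tau> ^^ ?q) (x i)"
      using L.twisted_power_coboundary[OF \<phi>_hom[OF \<tau>_closed], of "x i" "twist i" ?q] xi twist(1)[OF i]
      by (simp add: twisted_power_carrier_update)
    also have "\<dots> = x i"
      using xi \<phi>_pow[OF \<tau>_closed, of "x i" ?q] by (simp add: \<tau>_pow \<phi>_one)
    finally have tx: "?t \<otimes> x i = x i" .
    have t: "?t \<in> K" and eq: "z i \<otimes> y [^] ?q = ?t \<otimes> (y [^] ?q \<otimes> z i)"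
      using twist_pow[OF y_acts z_closed[OF i] _ twist(2)[OF i]] twist(1)[OF i] by auto
    have "?t = \<one>"
      using Units_r_cancel[OF K_unit(1)[OF xi(1)] K_subset[OF t] one_closed] tx xi(1) K_subset
      by simp
    then have "\<phi> (\<sigma> i) (y [^] ?q) \<otimes> z i = y [^] ?q \<otimes> z i"
      using eq actsD(4)[OF z_acts[OF i] yq] K_subset[OF yq] z_closed[OF i] by simp
    then show ?thesis
      using actsD(1)[OF z_acts[OF i]] K_subset[OF yq] K_subset[OF \<phi>_closed[OF \<sigma>_closed[OF i] yq]]
      by (blast intro: Units_r_cancel)
  qed
  then have "y [^] ?q \<in> ring_center R" using center yq by auto
  moreover have "\<tau> \<noteq> \<one>\<^bsub>G\<^esub>" using assms(1) by (metis G.ord_eq_1 \<tau>_closed not_prime_1)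
  ultimately show ?thesis
    using noncentral actsD(2)[OF y_acts] by (simp add: power_central_def)
qed

lemma power_central_imp_twist_coboundary:
  assumes q: "Factorial_Ring.prime q" and \<tau>: "\<tau> \<noteq> \<one>\<^bsub>G\<^esub>" and "power_central R q y"
  shows "G.ord \<tau> = q"
    and "i \<in> {1..r} \<Longrightarrow> \<exists>x\<in>K - {\<zero>}. twist i \<otimes> x = \<phi> \<tau> x"
proof -
  have yq: "y [^] q \<in> ring_center R" using assms(3) by (simp add: power_central_def)
  have \<tau>q: "\<tau> [^]\<^bsub>G\<^esub> q = \<one>\<^bsub>G\<^esub>"
    using acts_trivially[OF acts_pow[OF y_acts]] yq K_subset by (auto simp: ring_center_def)
  then have "G.ord \<tau> dvd q" using G.pow_eq_id[OF \<tau>_closed] by simp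
  then show ord: "G.ord \<tau> = q"
    using q \<tau> G.ord_eq_1[OF \<tau>_closed] by (auto simp: prime_nat_iff)
  \<comment> \<open>Faithfulness transfers the order of \<tau> in \<open>G\<close> to the order of
    the automorphism of \<open>K\<close>.\<close>
  have moves: "\<exists>k\<in>K. (\<phi> \<tau> ^^ j) k \<noteq> k" if "0 < j" "j < q" for j
  proof (rule ccontr)
    assume "\<not> ?thesis"
    then have "\<tau> [^]\<^bsub>G\<^esub> j = \<one>\<^bsub>G\<^esub>"
      using \<phi>_pow[OF \<tau>_closed] by (intro faithful) (auto simp: \<tau>_closed)
    then have "q dvd j" using G.pow_eq_id[OF \<tau>_closed] ord by simp
    then show False using that by (auto dest: dvd_imp_le)
  qed
  assume i: "i \<in> {1..r}"
  let ?t = "twisted_power R (\<phi> \<tau>) (twist i) q"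
  have t: "?t \<in> K" and eq: "z i \<otimes> y [^] q = ?t \<otimes> (y [^] q \<otimes> z i)"
    using twist_pow[OF y_acts z_closed[OF i] _ twist(2)[OF i]] twist(1)[OF i] by auto
  have unit: "y [^] q \<otimes> z i \<in> Units R"
    using actsD(1)[OF acts_mult[OF acts_pow[OF y_acts] z_acts[OF i]]] .
  have "?t \<otimes> (y [^] q \<otimes> z i) = y [^] q \<otimes> z i"
    using eq yq z_closed[OF i] by (simp add: ring_center_def)
  then have "?t = \<one>"
    using Units_closed[OF unit] by (intro Units_r_cancel[OF unit K_subset[OF t]]) simp_all
  then have norm: "twisted_power L (\<phi> \<tau>) (twist i) q = \<one>\<^bsub>L\<^esub>"
    by (simp add: twisted_power_carrier_update)
  have period: "(\<phi> \<tau> ^^ q) k = k" if "k \<in> carrier L" for k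
    using \<phi>_pow[OF \<tau>_closed, of k q] \<tau>q that by (simp add: \<phi>_one)
  have moves': "\<exists>k\<in>carrier L. (\<phi> \<tau> ^^ j) k \<noteq> k" if "0 < j" "j < q" for j
    using moves[OF that] by simp
  have "twist i \<in> carrier L" using twist(1)[OF i] by simp
  then obtain x where "x \<in> carrier L - {\<zero>\<^bsub>L\<^esub>}" "twist i \<otimes>\<^bsub>L\<^esub> x = \<phi> \<tau> x"
    using L.hilbert_90[OF \<phi>_hom[OF \<tau>_closed] prime_gt_0_nat[OF q] period moves' _ norm] by blast
  then show "\<exists>x\<in>K - {\<zero>}. twist i \<otimes> x = \<phi> \<tau> x" by auto
qed

end

text \<open>Exponents are not reduced modulo the orders of the \<open>\<sigma> i\<close>, so a
  nonzero \<open>m\<close> can induce the identity; then l z^m runs through all of K* as l varies.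
  The condition on \<open>sigma_pow\<close> keeps the element outside \<open>K\<close>, where
  q-power centrality reflects degeneracy.\<close>

theorem strongly_degenerate_iff:
  "strongly_degenerate R K G \<phi> r \<sigma> z \<longleftrightarrow>
    (\<exists>q :: nat. Factorial_Ring.prime q \<and>
       (\<exists>l \<in> K - {\<zero>}. \<exists>m :: nat \<Rightarrow> nat.
          (\<exists>i\<in>{1..r}. m i \<noteq> 0) \<and> sigma_pow G r \<sigma> m \<noteq> \<one>\<^bsub>G\<^esub> \<and>
          power_central R q (l \<otimes> z_pow R r z m)))"
    (is "_ \<longleftrightarrow> ?rhs")
proof
  assume "strongly_degenerate R K G \<phi> r \<sigma> z"
  then obtain m l x where q: "Factorial_Ring.prime (G.ord (sigma_pow G r \<sigma> m))" and l: "l \<in> K - {\<zero>}"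
    and x: "\<And>i. i \<in> {1..r} \<Longrightarrow> x i \<in> K - {\<zero>}"
    and u: "\<And>i. i \<in> {1..r} \<Longrightarrow> u_pow R r z i m =
      (\<phi> (sigma_pow G r \<sigma> m) (x i) \<otimes> inv (x i)) \<otimes> (l \<otimes> inv (\<phi> (\<sigma> i) l))"
    unfolding strongly_degenerate_def by blast
  have "power_central R (G.ord (sigma_pow G r \<sigma> m)) (l \<otimes> z_pow R r z m)"
    using twist_coboundary_imp_power_central[OF l q] x u degeneracy_iff_twist[OF l] by blast
  moreover have \<tau>: "sigma_pow G r \<sigma> m \<noteq> \<one>\<^bsub>G\<^esub>" using q by (metis G.ord_eq_1 sigma_pow_closed not_prime_1)
  moreover have "\<exists>i\<in>{1..r}. m i \<noteq> 0"
  proof (rule ccontr)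
    assume "\<not> ?thesis"
    then have "sigma_pow G r \<sigma> m = \<one>\<^bsub>G\<^esub>"
      unfolding sigma_pow_def by (intro G.finprod_one_eqI) auto
    with \<tau> show False by blast
  qed
  ultimately show ?rhs using q l by blast
next
  assume ?rhs
  then obtain q l m where q: "Factorial_Ring.prime q" and l: "l \<in> K - {\<zero>}" and \<tau>: "sigma_pow G r \<sigma> m \<noteq> \<one>\<^bsub>G\<^esub>"
    and y: "power_central R q (l \<otimes> z_pow R r z m)" by blast
  \<comment> \<open>The order of the induced automorphism is \<open>q\<close> itself, hence prime;
    the same \<open>l\<close> and \<open>m\<close> witness degeneracy.\<close>
  note * = power_central_imp_twist_coboundary[OF l q \<tau> y]
  obtain x where x: "\<And>i. i \<in> {1..r} \<Longrightarrow> x i \<in> K - {\<zero>} \<and> twist l m i \<otimes> x i = \<phi> (sigma_pow G r \<sigma> m) (x i)"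
    using *(2) by metis
  show "strongly_degenerate R K G \<phi> r \<sigma> z"
    unfolding strongly_degenerate_def
    using q *(1) l x degeneracy_iff_twist[OF l] by (intro exI[of _ m]) blast
qed

end

section \<open>Transfer to the given crossed product\<close>

theorem lemma1p7:
  fixes \<Delta> :: "('a, 'b) ring_scheme" and F K :: "'a set"
    and G :: "('g, 'c) monoid_scheme" and \<phi> :: "'g \<Rightarrow> 'a \<Rightarrow> 'a"
    and r :: nat and \<sigma> :: "nat \<Rightarrow> 'g" and z :: "nat \<Rightarrow> 'a"
    and u :: "nat \<Rightarrow> nat \<Rightarrow> 'a" and b :: "nat \<Rightarrow> 'a"
  assumes "comm_group G" and "finite (carrier G)" and "\<not> cyclic_group G"
    and "group_basis G r \<sigma>"
    and "G_galois_extension \<Delta> F K G \<phi>"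
    and "abelian_crossed_product \<Delta> F K G \<phi> r \<sigma> z u b"
  shows "strongly_degenerate \<Delta> K G \<phi> r \<sigma> z \<longleftrightarrow>
    (\<exists>q :: nat. Factorial_Ring.prime q \<and>
       (\<exists>l \<in> K - {\<zero>\<^bsub>\<Delta>\<^esub>}. \<exists>m :: nat \<Rightarrow> nat.
          (\<exists>i\<in>{1..r}. m i \<noteq> 0) \<and> sigma_pow G r \<sigma> m \<noteq> \<one>\<^bsub>G\<^esub> \<and>
          power_central \<Delta> q (l \<otimes>\<^bsub>\<Delta>\<^esub> z_pow \<Delta> r z m)))"
proof -
  have csa: "central_simple_algebra \<Delta> F" and max: "maximal_subfield \<Delta> F K"
    and z_unit: "\<And>i. i \<in> {1..r} \<Longrightarrow> z i \<in> Units \<Delta>"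
    and z_conj: "\<And>i k. \<lbrakk>i \<in> {1..r}; k \<in> K\<rbrakk> \<Longrightarrow>
      z i \<otimes>\<^bsub>\<Delta>\<^esub> k \<otimes>\<^bsub>\<Delta>\<^esub> inv\<^bsub>\<Delta>\<^esub> (z i) = \<phi> (\<sigma> i) k"
    and u: "\<And>i j. \<lbrakk>i \<in> {1..r}; j \<in> {1..r}\<rbrakk> \<Longrightarrow>
      u i j = z i \<otimes>\<^bsub>\<Delta>\<^esub> z j \<otimes>\<^bsub>\<Delta>\<^esub> inv\<^bsub>\<Delta>\<^esub> (z i) \<otimes>\<^bsub>\<Delta>\<^esub> inv\<^bsub>\<Delta>\<^esub> (z j) \<and> u i j \<in> K - {\<zero>\<^bsub>\<Delta>\<^esub>}"
    and b: "\<And>i. i \<in> {1..r} \<Longrightarrow>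
      b i = z i [^]\<^bsub>\<Delta>\<^esub> group.ord G (\<sigma> i) \<and> b i \<in> K - {\<zero>\<^bsub>\<Delta>\<^esub>}"
    using assms(6) unfolding abelian_crossed_product_def by blast+
  interpret G: comm_group G by fact
  interpret \<Delta>: ring \<Delta> using csa by (simp add: central_simple_algebra_def)
  have K: "subfield K \<Delta>" using max by (simp add: maximal_subfield_def)
  have iso: "\<phi> \<in> iso G (galois_group \<Delta> F K)" and gal: "galois_extension \<Delta> F K"
    using assms(5) by (auto simp: G_galois_extension_def)
  have \<phi>_image: "\<phi> ` carrier G = carrier (galois_group \<Delta> F K)" and inj: "inj_on \<phi> (carrier G)"
    using iso by (auto simp: iso_def bij_betw_def)
  have \<phi>_mem: "\<phi> g \<in> carrier (galois_group \<Delta> F K)" if "g \<in> carrier G" for g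
    using \<phi>_image that by blast
  have \<phi>_Bij: "\<phi> g \<in> Bij K" if "g \<in> carrier G" for g
    using \<phi>_mem[OF that] by (simp add: galois_group_def)
  have \<phi>_mult: "\<phi> (g \<otimes>\<^bsub>G\<^esub> h) k = \<phi> g (\<phi> h k)"
    if "g \<in> carrier G" "h \<in> carrier G" "k \<in> K" for g h k
    using iso that \<phi>_Bij[of g] \<phi>_Bij[of h]
    by (simp add: iso_def hom_def galois_group_def BijGroup_def compose_def)
  have \<phi>_one: "\<phi> \<one>\<^bsub>G\<^esub> k = k" if "k \<in> K" for k
  proof -
    have "inj_on (\<phi> \<one>\<^bsub>G\<^esub>) K" "\<phi> \<one>\<^bsub>G\<^esub> k \<in> K"
      using \<phi>_Bij[OF G.one_closed] that by (auto simp: Bij_def bij_betw_def)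
    then show ?thesis
      using \<phi>_mult[OF G.one_closed G.one_closed that] that by (simp add: inj_on_eq_iff)
  qed
  interpret galois_action \<Delta> K G \<phi>
  proof (intro galois_action.intro galois_action_axioms.intro)
    fix g assume g: "g \<in> carrier G"
    show "\<phi> g \<in> ring_hom (\<Delta>\<lparr>carrier := K\<rparr>) (\<Delta>\<lparr>carrier := K\<rparr>)"
      using \<phi>_mem[OF g] by (simp add: galois_group_def)
    \<comment> \<open>Members of \<open>Bij K\<close> are extensional, so agreement on
      \<open>K\<close> gives equality of functions, and injectivity of \<phi> applies.\<close>
    assume "\<And>k. k \<in> K \<Longrightarrow> \<phi> g k = k"
    then have "\<phi> g = \<phi> \<one>\<^bsub>G\<^esub>"
      using g \<phi>_Bij \<phi>_one by (intro extensionalityI[of _ K]) (auto intro: Bij_imp_extensional)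
    then show "g = \<one>\<^bsub>G\<^esub>" using inj g by (simp add: inj_on_eq_iff)
  qed (fact K \<phi>_mult \<phi>_one \<Delta>.ring_axioms G.group_axioms)+
  have \<sigma>: "\<sigma> i \<in> carrier G" if "i \<in> {1..r}" for i
    using assms(4) that by (simp add: group_basis_def)
  have basis: "(\<lambda>f. finprod G f {1..r}) \<in>
      iso (product_group {1..r} (\<lambda>i. subgroup_generated G {\<sigma> i})) G"
    using assms(4) by (simp add: group_basis_def)
  have F: "ring_center \<Delta> = F" using csa by (simp add: central_simple_algebra_def)
  have fixed: "F = {k \<in> K. \<forall>g\<in>carrier G. \<phi> g k = k}"
    using gal by (simp add: galois_extension_def flip: \<phi>_image)
  interpret abelian_crossing \<Delta> K G \<phi> r \<sigma> z
  proof
    fix i assume i: "i \<in> {1..r}"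
    show "acts (z i) (\<sigma> i)"
      unfolding acts_def
    proof (intro conjI ballI)
      fix k assume k: "k \<in> K"
      have "\<phi> (\<sigma> i) k \<otimes>\<^bsub>\<Delta>\<^esub> z i = z i \<otimes>\<^bsub>\<Delta>\<^esub> k \<otimes>\<^bsub>\<Delta>\<^esub> inv\<^bsub>\<Delta>\<^esub> z i \<otimes>\<^bsub>\<Delta>\<^esub> z i"
        by (simp only: z_conj[OF i k])
      also have "\<dots> = z i \<otimes>\<^bsub>\<Delta>\<^esub> k"
        using z_unit[OF i] \<Delta>.Units_closed[OF z_unit[OF i]] K_subset[OF k] by (simp add: \<Delta>.m_assoc)
      finally show "z i \<otimes>\<^bsub>\<Delta>\<^esub> k = \<phi> (\<sigma> i) k \<otimes>\<^bsub>\<Delta>\<^esub> z i" ..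
    qed (use z_unit \<sigma> i in auto)
    show "z i [^]\<^bsub>\<Delta>\<^esub> G.ord (\<sigma> i) \<in> K - {\<zero>\<^bsub>\<Delta>\<^esub>}"
      using b[OF i] by metis
    show "commutes_mod_K (z i) (z j)" if j: "j \<in> {1..r}" for j
    proof -
      have carr: "z i \<in> carrier \<Delta>" "z j \<in> carrier \<Delta>" "inv\<^bsub>\<Delta>\<^esub> (z i) \<in> carrier \<Delta>" "inv\<^bsub>\<Delta>\<^esub> (z j) \<in> carrier \<Delta>"
        using z_unit[OF i] z_unit[OF j] by auto
      \<comment> \<open>The matrix entry \<open>u i j\<close> is the scalar witnessing commutation
        modulo K*.\<close>
      have "u i j \<otimes>\<^bsub>\<Delta>\<^esub> (z j \<otimes>\<^bsub>\<Delta>\<^esub> z i) =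
          z i \<otimes>\<^bsub>\<Delta>\<^esub> z j \<otimes>\<^bsub>\<Delta>\<^esub> (inv\<^bsub>\<Delta>\<^esub> (z i) \<otimes>\<^bsub>\<Delta>\<^esub> ((inv\<^bsub>\<Delta>\<^esub> (z j) \<otimes>\<^bsub>\<Delta>\<^esub> z j) \<otimes>\<^bsub>\<Delta>\<^esub> z i))"
        using carr by (simp only: u[OF i j, THEN conjunct1] \<Delta>.m_assoc \<Delta>.m_closed)
      also have "\<dots> = z i \<otimes>\<^bsub>\<Delta>\<^esub> z j"
        using carr z_unit[OF i] z_unit[OF j] by simp
      finally show ?thesis using u[OF i j] unfolding commutes_mod_K_def by metis
    qed
    show "\<sigma> i [^]\<^bsub>G\<^esub> m i = \<one>\<^bsub>G\<^esub>" if "sigma_pow G r \<sigma> m = \<one>\<^bsub>G\<^esub>" for m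
    proof -
      let ?P = "product_group {1..r} (\<lambda>i. subgroup_generated G {\<sigma> i})"
      \<comment> \<open>Both tuples have product 1, so injectivity of the product map identifies
        them. They are restricted to the index set in order to lie in the carrier of the product
        group.\<close>
      let ?f = "\<lambda>i\<in>{1..r}. \<sigma> i [^]\<^bsub>G\<^esub> m i" and ?e = "\<lambda>i\<in>{1..r}. \<one>\<^bsub>G\<^esub>"
      have mem: "\<sigma> j [^]\<^bsub>G\<^esub> n \<in> carrier (subgroup_generated G {\<sigma> j})" if "j \<in> {1..r}" for j and n :: nat
        using G.carrier_subgroup_generated_by_singleton[OF \<sigma>[OF that]]
        by (auto simp flip: int_pow_int)
      have inj: "inj_on (\<lambda>f. finprod G f {1..r}) (carrier ?P)"
        using basis unfolding iso_def bij_betw_def by simp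
      have "finprod G ?f {1..r} = sigma_pow G r \<sigma> m"
        unfolding sigma_pow_def using \<sigma> by (intro G.finprod_cong) (auto simp: simp_implies_def)
      moreover have "finprod G ?e {1..r} = \<one>\<^bsub>G\<^esub>"
        by (intro G.finprod_one_eqI) auto
      ultimately have "finprod G ?f {1..r} = finprod G ?e {1..r}" using that by simp
      moreover have "?f \<in> carrier ?P" using mem by simp
      moreover have "?e \<in> carrier ?P" using mem[of _ 0] by simp
      ultimately have "?f = ?e" by (rule inj_onD[OF inj])
      then have "?f i = ?e i" by (rule fun_cong)
      then show ?thesis using i by simp
    qed
  next
    \<comment> \<open>Surjectivity of the product map makes the basis a generating set. Applied to
      the stabilizer of \<open>k\<close>, this reduces invariance under \<open>G\<close> to
      invariance under the \<open>\<sigma> i\<close>.\<close>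
    have generated: "g \<in> H" if H: "subgroup H G" "\<sigma> ` {1..r} \<subseteq> H" and g: "g \<in> carrier G" for g H
    proof -
      obtain f where f: "f \<in> (\<Pi>\<^sub>E i\<in>{1..r}. carrier (subgroup_generated G {\<sigma> i}))"
        and "g = finprod G f {1..r}"
        using basis g by (auto simp: iso_def bij_betw_def)
      have "carrier (subgroup_generated G {\<sigma> i}) \<subseteq> H" if "i \<in> {1..r}" for i
        using H that by (intro G.subgroup_generated_minimal) auto
      then have fH: "f i \<in> H" if "i \<in> {1..r}" for i
        using PiE_mem[OF f that] that by blast
      interpret H: subgroup H G by fact
      have "finprod G f A \<in> H" if "finite A" "A \<subseteq> {1..r}" for A
        using that
      proof induction
        case (insert i A)
        then have "finprod G f (insert i A) = f i \<otimes>\<^bsub>G\<^esub> finprod G f A"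
          using fH by (intro G.finprod_insert) (auto simp: subset_iff)
        with insert fH show ?case by simp
      qed simp
      then show ?thesis using \<open>g = _\<close> by simp
    qed
    have "\<phi> g k = k" if k: "k \<in> K" "\<And>i. i \<in> {1..r} \<Longrightarrow> \<phi> (\<sigma> i) k = k" and g: "g \<in> carrier G" for g k
    proof -
      let ?H = "{g \<in> carrier G. \<phi> g k = k}"
      have "subgroup ?H G"
      proof (rule G.subgroupI)
        show "inv\<^bsub>G\<^esub> h \<in> ?H" if "h \<in> ?H" for h
          using that k \<phi>_mult[of "inv\<^bsub>G\<^esub> h" h k] \<phi>_one[of k] by auto
      qed (use k \<phi>_one \<phi>_mult in auto)
      moreover have "\<sigma> ` {1..r} \<subseteq> ?H" using k \<sigma> by blast
      ultimately show ?thesis using generated g by blast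
    qed
    then show "ring_center \<Delta> = {k \<in> K. \<forall>i\<in>{1..r}. \<phi> (\<sigma> i) k = k}"
      unfolding F using \<sigma> by (subst fixed) blast
  qed
  show ?thesis by (rule strongly_degenerate_iff)
qed

end
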